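(* Let $\psi=g+\pi$ on $\mathbb{R}^d$ with $g$ convex and generalized smooth and $\pi$ convex (i.e. $\mu=0$), and let $x^\star$ be a minimizer of $\psi$. Run AGLS (described in the context) with $\mu=0$, $\alpha_1=1$ and the remaining parameters chosen as in the context, and suppose that the line search succeeds for all $t=1,\dots,T$. Then all the iterates $x^t,y^t,z^t$ of AGLS remain in $\mathcal{B}_{D_1^\star}(x^\star)=\{x:\|x-x^\star\|\le D_1^\star\}$, where $D_1^\star:=\|x^0-x^\star\|$. Moreover, $$\psi(y^T)-\psi(x^\star)\le\frac{2\tau_uL_1^\star}{(T+1)^2}\|x^\star-x^0\|^2,$$ where $L_1^\star=\sup\{2\mathcal{L}(x,y):x,y\in\mathcal{B}_{D_1^\star}(x^\star)\}$.
   Context: Setting. $\pi:\mathbb{R}^d\to(-\infty,+\infty]$ is proper, lower semicontinuous and $\mu$-strongly convex with $\mu\ge0$ ($\mu=0$ meaning convex). $g:\mathbb{R}^d\to\mathbb{R}$ is convex, differentiable and generalized smooth: $\|\nabla g(y)-\nabla g(x)\|\le\mathcal{L}(x,y)\|y-x\|$ for all $x,y$, with $\mathcal{L}:\mathbb{R}^d\times\mathbb{R}^d\to(0,\infty)$ symmetric and continuous. AGLS (accelerated gradient method with line search, no early stop). Inputs: $x^0\in\operatorname{dom}\pi$, $\mu\ge0$, $L_0\in(0,\infty)$, $\tau_d\in(0,1)$, $\tau_u\in(1,\infty)$. Set $y^0=z^0=x^0$, $\hat L_0=L_0$. For $t=1,\dots,T$: let $\bar L_t=\tau_d\hat L_{t-1}$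 and let $k_t$ be the smallest nonnegative integer such that, with $\hat L_t=\bar L_t\tau_u^{k_t}$, the points $$x^t=(1-\alpha_t)y^{t-1}+\alpha_t((1-\beta_t)y^{t-1}+\beta_tz^{t-1}),$$ $$z^t=\arg\min_x\{\langle\nabla g(x^t),x\rangle+\pi(x)+\tfrac{\gamma_t}{2}\|x-z^{t-1}\|^2\},\qquad y^t=(1-\alpha_t)y^{t-1}+\alpha_tz^t$$ satisfy $g(y^t)\le g(x^t)+\langle\nabla g(x^t),y^t-x^t\rangle+\frac{\hat L_t}{2}\|y^t-x^t\|^2$. The line search "succeeds" at $t$ if such a $k_t$ exists. Parameter choice: $\gamma_t=(\hat L_t+\mu)\alpha_t-\mu$, $\beta_t=\frac{\gamma_t}{\hat L_t\alpha_t}$, and for $t\ge2$, $\alpha_t\in(0,1)$ is the solution of $(\hat L_t+\mu)\alpha_t^2+(b_{t-1}-\mu)\alpha_t-b_{t-1}=0$, where $b_t=\alpha_t^2(\hat L_t+\mu)$.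
   Formalization: The convergence rate is proved under the added condition τ_d L_0 ≤ τ_u L_1^⋆; for arbitrary L_0 > 0 it is false (g=0, 𝓛=1/100, π=|x|, x^0=10, L_0=1, τ_d=1/2, τ_u=2, T=1: gap 8, claimed bound 2). The ball claim needs no such condition. *)

theory Defs
  imports "HOL-Analysis.Analysis"
begin

section \<open>Function classes\<close>

definition proper :: "('a \<Rightarrow> ereal) \<Rightarrow> bool" where
  "proper f \<longleftrightarrow> (\<forall>x. f x \<noteq> -\<infinity>) \<and> (\<exists>x. f x \<noteq> \<infinity>)"

definition domain_of :: "('a \<Rightarrow> ereal) \<Rightarrow> 'a set" where
  "domain_of f = {x. f x < \<infinity>}"

definition lower_semicontinuous :: "('a::topological_space \<Rightarrow> ereal) \<Rightarrow> bool" where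
  "lower_semicontinuous f \<longleftrightarrow> (\<forall>x. f x \<le> Liminf (at x) f)"

text \<open>For functions that never take the value \<open>-\<infinity>\<close>. The case \<open>\<mu> = 0\<close> is plain convexity.
  At the end points \<open>c \<in> {0, 1}\<close> the library convention \<open>0 * \<infinity> = 0\<close> makes the
  inequality trivial.\<close>

definition strongly_convex :: "real \<Rightarrow> ('a::real_normed_vector \<Rightarrow> ereal) \<Rightarrow> bool" where
  "strongly_convex \<mu> f \<longleftrightarrow>
     (\<forall>x y. \<forall>c\<in>{0..1}.
        f ((1 - c) *\<^sub>R x + c *\<^sub>R y) + ereal (\<mu> / 2 * c * (1 - c) * (norm (x - y))\<^sup>2)
          \<le> ereal (1 - c) * f x + ereal c * f y)"

definition grad :: "('a::real_inner \<Rightarrow> real) \<Rightarrow> 'a \<Rightarrow> 'a" where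
  "grad g x = (THE D. GDERIV g x :> D)"

lemma GDERIV_grad:
  fixes g :: "'a::euclidean_space \<Rightarrow> real"
  assumes "g differentiable (at x)"
  shows "GDERIV g x :> grad g x"
proof -
  obtain g' where g': "(g has_derivative g') (at x)"
    using assms by (auto simp: differentiable_def)
  have "linear g'"
    using g' has_derivative_linear by blast
  then have "g' = (\<lambda>h. h \<bullet> adjoint g' 1)"
    using adjoint_works[of g' _ 1] by (simp add: fun_eq_iff)
  with g' have ex: "GDERIV g x :> adjoint g' 1"
    unfolding gderiv_def by metis
  moreover have "D = D'" if "GDERIV g x :> D" "GDERIV g x :> D'" for D D'
  proof -
    have "(\<lambda>h. h \<bullet> D) = (\<lambda>h. h \<bullet> D')"
      using that unfolding gderiv_def by (rule has_derivative_unique)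
    then show ?thesis
      by (metis vector_eq_ldot)
  qed
  ultimately show ?thesis
    unfolding grad_def by (metis theI)
qed

definition generalized_smooth ::
    "('a::real_inner \<Rightarrow> real) \<Rightarrow> ('a \<Rightarrow> 'a \<Rightarrow> real) \<Rightarrow> bool" where
  "generalized_smooth g \<L> \<longleftrightarrow>
     (\<forall>x. g differentiable (at x)) \<and>
     (\<forall>x y. 0 < \<L> x y) \<and> (\<forall>x y. \<L> x y = \<L> y x) \<and>
     continuous_on UNIV (\<lambda>p. \<L> (fst p) (snd p)) \<and>
     (\<forall>x y. norm (grad g y - grad g x) \<le> \<L> x y * norm (y - x))"

section \<open>Accelerated gradient method with line search\<close>

text \<open>The state after iteration \<open>t\<close>: the accepted line-search estimate of the smoothness constant,
  the weight \<open>\<alpha>\<^sub>t\<close> and the points \<open>x\<^sup>t\<close>, \<open>z\<^sup>t\<close>, \<open>y\<^sup>t\<close>.\<close>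

record 'a agls_state =
  Lhat :: real
  weight :: real
  xpt :: 'a
  zpt :: 'a
  ypt :: 'a

definition agls_b :: "real \<Rightarrow> 'a agls_state \<Rightarrow> real" where
  "agls_b \<mu> s = (weight s)\<^sup>2 * (Lhat s + \<mu>)"

text \<open>For \<open>L > 0\<close> and \<open>b > 0\<close> the quadratic is convex, equal to \<open>-b < 0\<close> at \<open>0\<close> and to
  \<open>L > 0\<close> at \<open>1\<close>, so it has exactly one root in \<open>(0, 1)\<close>.\<close>

definition agls_alpha :: "real \<Rightarrow> real \<Rightarrow> real \<Rightarrow> real" where
  "agls_alpha \<mu> b L =
     (THE \<alpha>. 0 < \<alpha> \<and> \<alpha> < 1 \<and> (L + \<mu>) * \<alpha>\<^sup>2 + (b - \<mu>) * \<alpha> - b = 0)"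

text \<open>The state produced from \<open>s\<close> in iteration \<open>t\<close> by the trial value \<open>L\<close>; all parameters and
  points depend on \<open>L\<close>, so they are recomputed for every trial. For \<open>t = 1\<close> the weight is the
  input \<open>\<alpha>1\<close>.\<close>

definition agls_trial ::
    "('a::real_inner \<Rightarrow> real) \<Rightarrow> ('a \<Rightarrow> ereal) \<Rightarrow> real \<Rightarrow> real \<Rightarrow> nat \<Rightarrow> 'a agls_state \<Rightarrow> real
       \<Rightarrow> 'a agls_state" where
  "agls_trial g \<pi> \<mu> \<alpha>1 t s L =
     (let \<alpha> = (if t = 1 then \<alpha>1 else agls_alpha \<mu> (agls_b \<mu> s) L);
          \<gamma> = (L + \<mu>) * \<alpha> - \<mu>;
          \<beta> = \<gamma> / (L * \<alpha>);
          x = (1 - \<alpha>) *\<^sub>R ypt s + \<alpha> *\<^sub>R ((1 - \<beta>) *\<^sub>R ypt s + \<beta> *\<^sub>R zpt s);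
          z = (ARG_MIN (\<lambda>u. ereal (grad g x \<bullet> u) + \<pi> u
                             + ereal (\<gamma> / 2 * (norm (u - zpt s))\<^sup>2)) u. True);
          y = (1 - \<alpha>) *\<^sub>R ypt s + \<alpha> *\<^sub>R z
      in \<lparr>Lhat = L, weight = \<alpha>, xpt = x, zpt = z, ypt = y\<rparr>)"

definition agls_accepts :: "('a::real_inner \<Rightarrow> real) \<Rightarrow> 'a agls_state \<Rightarrow> bool" where
  "agls_accepts g s \<longleftrightarrow>
     g (ypt s) \<le> g (xpt s) + grad g (xpt s) \<bullet> (ypt s - xpt s)
                 + Lhat s / 2 * (norm (ypt s - xpt s))\<^sup>2"

text \<open>The state tried in iteration \<open>t\<close> from \<open>s\<close> with exponent \<open>k\<close>.\<close>

definition agls_backtrack ::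
    "('a::real_inner \<Rightarrow> real) \<Rightarrow> ('a \<Rightarrow> ereal) \<Rightarrow> real \<Rightarrow> real \<Rightarrow> real \<Rightarrow> real \<Rightarrow> nat
       \<Rightarrow> 'a agls_state \<Rightarrow> nat \<Rightarrow> 'a agls_state" where
  "agls_backtrack g \<pi> \<mu> \<tau>d \<tau>u \<alpha>1 t s k =
     agls_trial g \<pi> \<mu> \<alpha>1 t s (\<tau>d * Lhat s * \<tau>u ^ k)"

text \<open>The value is meaningful only as long as the line search has succeeded, since otherwise
  \<open>LEAST\<close> is unspecified. The initial fields \<open>weight\<close> and \<open>xpt\<close> are never read.\<close>

primrec agls ::
    "('a::real_inner \<Rightarrow> real) \<Rightarrow> ('a \<Rightarrow> ereal) \<Rightarrow> real \<Rightarrow> real \<Rightarrow> real \<Rightarrow> real \<Rightarrow> real \<Rightarrow> 'a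
       \<Rightarrow> nat \<Rightarrow> 'a agls_state" where
  "agls g \<pi> \<mu> \<tau>d \<tau>u \<alpha>1 L0 x0 0 = \<lparr>Lhat = L0, weight = 1, xpt = x0, zpt = x0, ypt = x0\<rparr>"
| "agls g \<pi> \<mu> \<tau>d \<tau>u \<alpha>1 L0 x0 (Suc n) =
     (let s = agls g \<pi> \<mu> \<tau>d \<tau>u \<alpha>1 L0 x0 n
      in agls_backtrack g \<pi> \<mu> \<tau>d \<tau>u \<alpha>1 (Suc n) s
           (LEAST k. agls_accepts g (agls_backtrack g \<pi> \<mu> \<tau>d \<tau>u \<alpha>1 (Suc n) s k)))"

definition agls_succeeds ::
    "('a::real_inner \<Rightarrow> real) \<Rightarrow> ('a \<Rightarrow> ereal) \<Rightarrow> real \<Rightarrow> real \<Rightarrow> real \<Rightarrow> real \<Rightarrow> real \<Rightarrow> 'a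
       \<Rightarrow> nat \<Rightarrow> bool" where
  "agls_succeeds g \<pi> \<mu> \<tau>d \<tau>u \<alpha>1 L0 x0 t \<longleftrightarrow>
     (\<exists>k. agls_accepts g
            (agls_backtrack g \<pi> \<mu> \<tau>d \<tau>u \<alpha>1 t (agls g \<pi> \<mu> \<tau>d \<tau>u \<alpha>1 L0 x0 (t - 1)) k))"

end

(* One accepted step gives, with b = \<alpha>^2 L,
     gap y' + b/2 |x* - z'|^2 <= (1 - \<alpha>) gap y + b/2 |x* - z|^2,
   and the rule for \<alpha> makes b = (1 - \<alpha>) b_prev, so gap y / b + |x* - z|^2 / 2 never increases;
   this confines z, hence also x and y, to the ball. The same recursion makes 1 / sqrt b grow by at
   least 1 / (2 sqrt M) per step as long as all accepted L are at most M.
   The delicate point is M = \<tau>u L1, because a rejected trial may leave the ball, where L1 says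
   nothing. Trial points depend continuously on L, and above L1 the trial points in the ball are
   exactly those with 2 \<L> < L; by connectedness, once some L > L1 is accepted all of them are.
   So a rejected trial that precedes an accepted one has L <= L1. *)

theory Submission
  imports Defs
begin

section \<open>First-order conditions and lower semicontinuity\<close>

text \<open>As a function of \<open>c\<close>, \<open>h (w + c *\<^sub>R d) + c * K\<close> has
  slope \<open>D \<bullet> d + K\<close> at \<open>0\<close>; a negative slope would push it below
  \<open>h w\<close> for small \<open>c > 0\<close>. The constant \<open>K\<close> carries a linear
  bound on the change of a further term.\<close>

lemma first_order_inequality:
  fixes h :: "'a::real_inner \<Rightarrow> real"
  assumes h: "GDERIV h w :> D"
    and le: "\<And>c. 0 < c \<Longrightarrow> c < 1 \<Longrightarrow> h w \<le> h (w + c *\<^sub>R d) + c * K"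
  shows "0 \<le> D \<bullet> d + K"
proof (rule ccontr)
  assume neg: "\<not> 0 \<le> D \<bullet> d + K"
  have line: "((\<lambda>c. w + c *\<^sub>R d) has_derivative (\<lambda>c. c *\<^sub>R d)) (at 0)"
    by (auto intro!: derivative_eq_intros)
  have "(h has_derivative (\<lambda>v. v \<bullet> D)) (at (w + 0 *\<^sub>R d))"
    using h by (simp add: gderiv_def)
  from has_derivative_compose[OF line this]
  have "((\<lambda>c. h (w + c *\<^sub>R d)) has_real_derivative D \<bullet> d) (at 0)"
    by (simp add: has_field_derivative_def inner_commute mult_commute_abs)
  then have "((\<lambda>c. h (w + c *\<^sub>R d) + c * K) has_real_derivative D \<bullet> d + K) (at 0)"
    by (auto intro!: derivative_eq_intros)
  with neg obtain e where e: "e > 0"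
    and dec: "\<And>c. c > 0 \<Longrightarrow> c < e \<Longrightarrow> h (w + c *\<^sub>R d) + c * K < h w"
    using DERIV_neg_dec_right[of "\<lambda>c. h (w + c *\<^sub>R d) + c * K" "D \<bullet> d + K" 0] by auto
  define c where "c = min (1/2) (e/2)"
  have "0 < c" "c < 1" "c < e"
    using e by (auto simp: c_def)
  then show False
    using le[of c] dec[of c] by simp
qed

lemma convex_on_gradient_ineq:
  fixes g :: "'a::real_inner \<Rightarrow> real"
  assumes "convex_on UNIV g" and "GDERIV g x :> D"
  shows "g x + D \<bullet> (y - x) \<le> g y"
proof -
  \<comment> \<open>Convexity in the form that \<open>first_order_inequality\<close> expects for
    \<open>- g\<close>, with \<open>K = g y - g x\<close>.\<close>
  have "- g x \<le> - g (x + c *\<^sub>R (y - x)) + c * (g y - g x)" if "0 < c" "c < 1" for c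
  proof -
    have "g ((1 - c) *\<^sub>R x + c *\<^sub>R y) \<le> (1 - c) * g x + c * g y"
      using assms(1) that unfolding convex_on_def by simp
    moreover have "(1 - c) *\<^sub>R x + c *\<^sub>R y = x + c *\<^sub>R (y - x)"
      by (simp add: algebra_simps)
    ultimately show ?thesis
      by (simp add: algebra_simps)
  qed
  from first_order_inequality[OF GDERIV_minus[OF assms(2)] this] show ?thesis
    by simp
qed

text \<open>Open strict superlevel sets express lower semicontinuity. Without a minimizer the sets
  \<open>{u. F v < F u}\<close> with \<open>v \<in> K\<close> cover \<open>K\<close>, but a finite
  subcover misses its own centre of smallest value.\<close>

lemma compact_attains_min_open_superlevel:
  fixes F :: "'a::topological_space \<Rightarrow> 'b::linorder"
  assumes K: "compact K" "K \<noteq> {}" and op: "\<And>c. open {u. c < F u}"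
  obtains w where "w \<in> K" "\<And>u. u \<in> K \<Longrightarrow> F w \<le> F u"
proof (rule ccontr)
  assume "\<not> thesis"
  with that have "\<And>w. w \<in> K \<Longrightarrow> \<exists>v\<in>K. F v < F w"
    by (meson not_le_imp_less)
  then have "K \<subseteq> (\<Union>v\<in>K. {u. F v < F u})"
    by blast
  then obtain C where C: "C \<subseteq> K" "finite C" "K \<subseteq> (\<Union>v\<in>C. {u. F v < F u})"
    using compactE_image[OF K(1), of K "\<lambda>v. {u. F v < F u}"] op by metis
  then have "C \<noteq> {}"
    using K(2) by auto
  then obtain v where v: "v \<in> C" "F v = Min (F ` C)"
    using C(2) by (metis (no_types, lifting) Min_in finite_imageI image_iff image_is_empty)
  then obtain v' where "v' \<in> C" "F v' < F v"
    using C by blast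
  then show False
    using v C(2) by (metis Min_le finite_imageI image_eqI not_le)
qed

lemma open_superlevel_lsc_plus_continuous:
  fixes f :: "'a::topological_space \<Rightarrow> ereal" and q :: "'a \<Rightarrow> real"
  assumes lsc: "lower_semicontinuous f" and ninf: "\<And>u. f u \<noteq> -\<infinity>"
    and q: "continuous_on UNIV q"
  shows "open {u. c < ereal (q u) + f u}"
proof (subst open_subopen, intro ballI)
  fix x assume "x \<in> {u. c < ereal (q u) + f u}"
  then have cx: "c < ereal (q x) + f x"
    by simp
  have "eventually (\<lambda>u. c < ereal (q u) + f u) (nhds x)"
  proof (cases c)
    case (real r)
    have "ereal (r - q x) < f x"
      using cx real by (cases "f x") auto
    \<comment> \<open>\<open>s\<close> splits the slack: near \<open>x\<close> it suffices that
      \<open>f u\<close> exceeds \<open>s\<close> and \<open>q u\<close> exceeds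
      \<open>r - s\<close>.\<close>
    then obtain s where s: "r - q x < s" "ereal s < f x"
      using ereal_dense2[of "ereal (r - q x)" "f x"] by auto
    have "ereal s < Liminf (at x) f"
      using s(2) lsc unfolding lower_semicontinuous_def by (meson less_le_trans)
    \<comment> \<open>\<open>Liminf (at x)\<close> ignores the point \<open>x\<close> itself; there
      \<open>s(2)\<close> takes over.\<close>
    then have "eventually (\<lambda>u. ereal s < f u) (nhds x)"
      using less_LiminfD s(2) by (auto simp: eventually_nhds_conv_at)
    moreover have "(q \<longlongrightarrow> q x) (nhds x)"
      using q by (simp add: continuous_on_def tendsto_at_iff_tendsto_nhds)
    then have "eventually (\<lambda>u. r - s < q u) (nhds x)"
      using s(1) by (intro order_tendstoD) auto
    ultimately show ?thesis
    proof eventually_elim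
      case (elim u)
      then show ?case
        using real by (cases "f u") auto
    qed
  next
    case PInf
    with cx show ?thesis by simp
  next
    case MInf
    have "- \<infinity> < ereal (q u) + f u" for u
      using ninf[of u] by (cases "f u") auto
    with MInf show ?thesis by simp
  qed
  then show "\<exists>T. open T \<and> x \<in> T \<and> T \<subseteq> {u. c < ereal (q u) + f u}"
    unfolding eventually_nhds by blast
qed

section \<open>The weight recursion\<close>

text \<open>At \<mu> = 0 the quadratic has a single positive root, and it lies in (0, 1), so
  \<open>THE\<close> picks it. The closed form serves continuity in \<open>L\<close>, the root
  equation serves the recursion for \<open>b\<close>.\<close>

lemma agls_alpha_0:
  assumes "0 < b" "0 < L"
  shows agls_alpha_0_eq: "agls_alpha 0 b L = (sqrt (b\<^sup>2 + 4 * L * b) - b) / (2 * L)"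
    and agls_alpha_0_pos: "0 < agls_alpha 0 b L"
    and agls_alpha_0_less_1: "agls_alpha 0 b L < 1"
    and agls_alpha_0_root: "L * (agls_alpha 0 b L)\<^sup>2 = (1 - agls_alpha 0 b L) * b"
proof -
  define r where "r = (sqrt (b\<^sup>2 + 4 * L * b) - b) / (2 * L)"
  have "2 * L * r + b = sqrt (b\<^sup>2 + 4 * L * b)"
    using assms by (simp add: r_def)
  then have "(2 * L * r + b)\<^sup>2 = b\<^sup>2 + 4 * L * b"
    using assms by simp
  then have "(4 * L) * (L * r\<^sup>2 + b * r) = (4 * L) * b"
    by (simp add: power2_eq_square algebra_simps)
  then have root: "L * r\<^sup>2 + b * r = b"
    using assms by simp
  have "sqrt (b\<^sup>2) < sqrt (b\<^sup>2 + 4 * L * b)"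
    using assms by (intro real_sqrt_less_mono) simp
  then have pos: "0 < r"
    using assms by (simp add: r_def)
  have "b * (1 - r) = L * r\<^sup>2"
    using root by (simp add: algebra_simps)
  also have "0 < \<dots>"
    using assms pos by simp
  finally have "0 < b * (1 - r)" .
  then have less: "r < 1"
    using assms by (simp add: zero_less_mult_iff)
  have eq: "agls_alpha 0 b L = r"
    unfolding agls_alpha_def
  proof (rule the_equality)
    show "0 < r \<and> r < 1 \<and> (L + 0) * r\<^sup>2 + (b - 0) * r - b = 0"
      using root pos less by simp
  next
    fix q assume q: "0 < q \<and> q < 1 \<and> (L + 0) * q\<^sup>2 + (b - 0) * q - b = 0"
    with root have "(q - r) * (L * (q + r) + b) = 0"
      by (simp add: power2_eq_square algebra_simps)
    moreover have "0 < L * (q + r) + b"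
      using q pos assms by (simp add: add_pos_pos)
    ultimately show "q = r"
      by simp
  qed
  show "agls_alpha 0 b L = (sqrt (b\<^sup>2 + 4 * L * b) - b) / (2 * L)"
    using eq by (simp add: r_def)
  show "0 < agls_alpha 0 b L" "agls_alpha 0 b L < 1"
    using eq pos less by simp_all
  show "L * (agls_alpha 0 b L)\<^sup>2 = (1 - agls_alpha 0 b L) * b"
    using root by (simp add: eq algebra_simps)
qed

text \<open>Needed to let the trial points vary continuously with the trial value.\<close>

lemma continuous_on_agls_alpha_0:
  assumes "0 < b"
  shows "continuous_on {0<..} (agls_alpha 0 b)"
proof -
  have "continuous_on {0<..} (\<lambda>L. (sqrt (b\<^sup>2 + 4 * L * b) - b) / (2 * L))"
    by (intro continuous_intros) auto
  then show ?thesis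
    using agls_alpha_0_eq[OF assms] by (subst continuous_on_cong[OF refl]) auto
qed

(* sqrt b' = \<alpha> sqrt L \<le> \<alpha> sqrt M together with sqrt (1 - \<alpha>) \<le> 1 - \<alpha> / 2 *)
lemma weight_recursion_decay:
  fixes b b' c L M \<alpha> :: real
  assumes b': "b' = L * \<alpha>\<^sup>2" "b' = (1 - \<alpha>) * b" and \<alpha>: "0 < \<alpha>" "\<alpha> < 1"
    and L: "0 < L" "L \<le> M" and c: "0 < c" "b * c\<^sup>2 \<le> 4 * M"
  shows "b' * (c + 1)\<^sup>2 \<le> 4 * M"
proof -
  have "0 < b'"
    using b'(1) \<alpha> L by simp
  then have "0 < b"
    using b'(2) \<alpha> by (simp add: zero_less_mult_iff)
  have "sqrt b' = \<alpha> * sqrt L"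
    using \<alpha> by (simp add: b'(1) real_sqrt_mult)
  also have "\<dots> \<le> \<alpha> * sqrt M"
    using \<alpha> L by (intro mult_left_mono) auto
  finally have 1: "sqrt b' \<le> \<alpha> * sqrt M" .
  have "sqrt (1 - \<alpha>) \<le> 1 - \<alpha> / 2"
    using \<alpha> by (intro real_le_lsqrt) (auto simp: power2_eq_square algebra_simps)
  moreover have "sqrt (b * c\<^sup>2) \<le> sqrt (4 * M)"
    using c(2) by (rule real_sqrt_le_mono)
  ultimately have "sqrt (1 - \<alpha>) * sqrt (b * c\<^sup>2) \<le> (1 - \<alpha> / 2) * sqrt (4 * M)"
    using \<alpha> \<open>0 < b\<close> by (intro mult_mono) auto
  then have "sqrt b' * c \<le> (1 - \<alpha> / 2) * (2 * sqrt M)"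
    using c(1) by (simp add: b'(2) real_sqrt_mult mult.assoc)
  \<comment> \<open>The deficit \<open>\<alpha> / 2 * (2 * sqrt M)\<close> is exactly the room that
    fact \<open>1\<close> needs for one more \<open>sqrt b'\<close>.\<close>
  with 1 have "sqrt b' * (c + 1) \<le> 2 * sqrt M"
    by (simp add: algebra_simps)
  then have "(sqrt b' * (c + 1))\<^sup>2 \<le> (2 * sqrt M)\<^sup>2"
    using \<open>0 < b'\<close> c(1) by (intro power_mono) auto
  then show ?thesis
    using \<open>0 < b'\<close> L by (simp add: power_mult_distrib)
qed

section \<open>The proximal step\<close>

locale composite_problem =
  fixes g :: "'a::euclidean_space \<Rightarrow> real" and \<pi> :: "'a \<Rightarrow> ereal" and \<L> and xs :: 'a
  assumes g_convex: "convex_on UNIV g"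
    and g_smooth: "generalized_smooth g \<L>"
    and pi_proper: "proper \<pi>"
    and pi_lsc: "lower_semicontinuous \<pi>"
    and pi_convex: "strongly_convex 0 \<pi>"
    and xs_min: "is_arg_min (\<lambda>u. ereal (g u) + \<pi> u) (\<lambda>_. True) xs"
begin

text \<open>Only meaningful on \<open>domain_of \<pi>\<close>; elsewhere it is the junk value \<open>0\<close>.\<close>

definition P :: "'a \<Rightarrow> real" where
  "P u = real_of_ereal (\<pi> u)"

definition gap :: "'a \<Rightarrow> real" where
  "gap u = (g u + P u) - (g xs + P xs)"

lemma pi_eq: "u \<in> domain_of \<pi> \<Longrightarrow> \<pi> u = ereal (P u)"
  using pi_proper unfolding proper_def domain_of_def P_def
  by (cases "\<pi> u") auto

lemma pi_eq_infinity: "u \<notin> domain_of \<pi> \<Longrightarrow> \<pi> u = \<infinity>"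
  by (simp add: domain_of_def)

lemma GDERIV_g: "GDERIV g x :> grad g x"
  using g_smooth by (simp add: generalized_smooth_def GDERIV_grad)

lemma g_above_tangent: "g x + grad g x \<bullet> (y - x) \<le> g y"
  using g_convex GDERIV_g by (rule convex_on_gradient_ineq)

text \<open>For fixed \<open>x\<close>, \<open>\<L> x y\<close> tends to \<open>\<L> x x\<close>, so
  the smoothness bound vanishes as \<open>y\<close> tends to \<open>x\<close>.\<close>

lemma continuous_grad: "continuous_on UNIV (grad g)"
proof -
  have "(grad g \<longlongrightarrow> grad g x) (at x)" for x
  proof (rule LIM_zero_cancel, rule Lim_null_comparison)
    show "\<forall>\<^sub>F y in at x. norm (grad g y - grad g x) \<le> \<L> x y * norm (y - x)"
      using g_smooth unfolding generalized_smooth_def by (intro always_eventually) blast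
    have "continuous_on UNIV (\<lambda>y. \<L> (fst (x, y)) (snd (x, y)))"
      using g_smooth unfolding generalized_smooth_def
      by (intro continuous_on_compose2[of UNIV "\<lambda>p. \<L> (fst p) (snd p)" UNIV "Pair x"])
        (auto intro!: continuous_intros)
    then have "((\<lambda>y. \<L> x y * norm (y - x)) \<longlongrightarrow> \<L> x x * norm (x - x)) (at x)"
      by (intro tendsto_intros) (auto simp: continuous_on_def)
    then show "((\<lambda>y. \<L> x y * norm (y - x)) \<longlongrightarrow> 0) (at x)"
      by simp
  qed
  then show ?thesis
    by (simp add: continuous_on_def)
qed

section \<open>Minimizers of a differentiable function plus \<pi>\<close>

lemma convex_P:
  assumes "u \<in> domain_of \<pi>" "v \<in> domain_of \<pi>" "0 \<le> c" "c \<le> 1"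
  shows "(1 - c) *\<^sub>R u + c *\<^sub>R v \<in> domain_of \<pi>"
    and "P ((1 - c) *\<^sub>R u + c *\<^sub>R v) \<le> (1 - c) * P u + c * P v"
proof -
  have "\<pi> ((1 - c) *\<^sub>R u + c *\<^sub>R v) \<le> ereal ((1 - c) * P u + c * P v)"
    using pi_convex[unfolded strongly_convex_def, rule_format, of c u v] assms
    by (simp add: pi_eq)
  moreover from this show "(1 - c) *\<^sub>R u + c *\<^sub>R v \<in> domain_of \<pi>"
    by (auto simp: domain_of_def)
  ultimately show "P ((1 - c) *\<^sub>R u + c *\<^sub>R v) \<le> (1 - c) * P u + c * P v"
    by (simp add: pi_eq)
qed

lemma minimizer_finite:
  assumes "is_arg_min (\<lambda>u. ereal (h u) + \<pi> u) (\<lambda>_. True) w"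
  shows "w \<in> domain_of \<pi>"
    and "u \<in> domain_of \<pi> \<Longrightarrow> h w + P w \<le> h u + P u"
proof -
  have min: "ereal (h w) + \<pi> w \<le> ereal (h u) + \<pi> u" for u
    using assms by (auto simp: is_arg_min_def not_less)
  obtain v where v: "v \<in> domain_of \<pi>"
    using pi_proper by (auto simp: proper_def domain_of_def)
  show w: "w \<in> domain_of \<pi>"
    using min[of v] pi_eq[OF v] by (cases "\<pi> w") (auto simp: domain_of_def)
  show "h w + P w \<le> h u + P u" if "u \<in> domain_of \<pi>"
    using min[of u] w that by (simp add: pi_eq)
qed

text \<open>Thus \<open>- D\<close> is a subgradient of \<open>P\<close> at \<open>w\<close>: along
  the segment towards \<open>u\<close>, convexity bounds the change of \<open>P\<close> linearly,
  and \<open>first_order_inequality\<close> handles \<open>h\<close>.\<close>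

lemma minimizer_subgradient:
  assumes min: "is_arg_min (\<lambda>u. ereal (h u) + \<pi> u) (\<lambda>_. True) w"
    and h: "GDERIV h w :> D" and u: "u \<in> domain_of \<pi>"
  shows "P w \<le> P u + D \<bullet> (u - w)"
proof -
  have "h w \<le> h (w + c *\<^sub>R (u - w)) + c * (P u - P w)" if c: "0 < c" "c < 1" for c
  proof -
    have eq: "w + c *\<^sub>R (u - w) = (1 - c) *\<^sub>R w + c *\<^sub>R u"
      by (simp add: algebra_simps)
    have "w + c *\<^sub>R (u - w) \<in> domain_of \<pi>"
      and "P (w + c *\<^sub>R (u - w)) \<le> (1 - c) * P w + c * P u"
      using convex_P[OF minimizer_finite(1)[OF min] u, of c] c by (auto simp: eq)
    with minimizer_finite(2)[OF min, of "w + c *\<^sub>R (u - w)"] show ?thesis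
      by (simp add: algebra_simps)
  qed
  from first_order_inequality[OF h this] show ?thesis
    by simp
qed

lemma xs_dom: "xs \<in> domain_of \<pi>"
  using minimizer_finite(1)[OF xs_min] .

lemma gap_nonneg: "u \<in> domain_of \<pi> \<Longrightarrow> 0 \<le> gap u"
  using minimizer_finite(2)[OF xs_min] by (simp add: gap_def)

text \<open>The objective is written as in \<open>agls_trial\<close> so that the
  \<open>ARG_MIN\<close> terms match. The data \<open>a\<close> and \<gamma> stay free, to compare
  steps made with different data.\<close>

definition prox :: "'a \<Rightarrow> real \<Rightarrow> 'a \<Rightarrow> 'a" where
  "prox a \<gamma> z = (ARG_MIN (\<lambda>u. ereal (a \<bullet> u) + \<pi> u + ereal (\<gamma> / 2 * (norm (u - z))\<^sup>2)) u. True)"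

lemma prox_objective:
  "ereal (a \<bullet> u) + \<pi> u + ereal (\<gamma> / 2 * (norm (u - z))\<^sup>2)
     = ereal (a \<bullet> u + \<gamma> / 2 * (norm (u - z))\<^sup>2) + \<pi> u"
  by (cases "\<pi> u") auto

(* The optimality condition at xs provides an affine minorant of \<pi>, hence quadratic growth. *)
lemma prox_exists:
  assumes "0 < \<gamma>"
  shows "\<exists>w. is_arg_min (\<lambda>u. ereal (a \<bullet> u + \<gamma> / 2 * (norm (u - z))\<^sup>2) + \<pi> u) (\<lambda>_. True) w"
proof -
  define q where "q u = a \<bullet> u + \<gamma> / 2 * (norm (u - z))\<^sup>2" for u
  define F where "F u = ereal (q u) + \<pi> u" for u
  \<comment> \<open>The affine minorant gives
    \<open>F u \<ge> K + e \<bullet> (u - z) + \<gamma> / 2 * s\<^sup>2\<close> with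
    \<open>s = norm (u - z)\<close>, and \<open>M\<close> is the excess of \<open>F xs\<close> over
    \<open>K\<close>. Beyond radius \<open>R\<close>, both \<open>s > 1\<close> and
    \<open>\<gamma> / 2 * s > norm e + \<bar>M\<bar>\<close>, so the quadratic term wins.\<close>
  define e where "e = a - grad g xs"
  define K where "K = P xs + grad g xs \<bullet> xs + e \<bullet> z"
  define M where "M = q xs + P xs - K"
  define R where "R = 1 + norm (xs - z) + 2 * (norm e + \<bar>M\<bar>) / \<gamma>"
  have far: "F xs < F u" if "u \<notin> cball z R" for u
  proof (cases "u \<in> domain_of \<pi>")
    case True
    define s where "s = norm (u - z)"
    have sR: "R < s"
      using that by (simp add: s_def dist_norm norm_minus_commute)
    moreover have "0 \<le> 2 * (norm e + \<bar>M\<bar>) / \<gamma>"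
      using assms by simp
    ultimately have "1 < s" "2 * (norm e + \<bar>M\<bar>) / \<gamma> < s"
      unfolding R_def using norm_ge_zero[of "xs - z"] by linarith+
    then have "norm e + \<bar>M\<bar> < \<gamma> / 2 * s"
      using assms by (simp add: field_simps)
    moreover have "s * \<bar>M\<bar> \<ge> \<bar>M\<bar>"
      using \<open>1 < s\<close> by (simp add: mult_le_cancel_right1)
    moreover have "s * \<bar>M\<bar> < s * (\<gamma> / 2 * s - norm e)"
      using \<open>1 < s\<close> calculation(1) by (intro mult_strict_left_mono) auto
    ultimately have "M < s * (\<gamma> / 2 * s - norm e)"
      by linarith
    then have "M < \<gamma> / 2 * s\<^sup>2 - norm e * s"
      by (simp add: algebra_simps power2_eq_square)
    moreover have "- (norm e * s) \<le> e \<bullet> (u - z)"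
      using Cauchy_Schwarz_ineq2[of e "u - z"] by (simp add: s_def abs_le_iff)
    moreover have "P xs \<le> P u + grad g xs \<bullet> (u - xs)"
      using minimizer_subgradient[OF xs_min GDERIV_g True] .
    ultimately have "q xs + P xs < q u + P u"
      unfolding M_def K_def q_def e_def s_def by (simp add: inner_simps)
    with True xs_dom show ?thesis
      by (simp add: F_def pi_eq)
  next
    case False
    with xs_dom show ?thesis
      by (simp add: F_def pi_eq pi_eq_infinity)
  qed
  have "open {u. c < F u}" for c
    unfolding F_def q_def
    using pi_lsc pi_proper
    by (intro open_superlevel_lsc_plus_continuous continuous_intros) (auto simp: proper_def)
  \<comment> \<open>Outside the ball, \<open>far\<close> would yield
    \<open>F xs < F xs\<close>.\<close>
  moreover have "xs \<in> cball z R"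
    using far[of xs] by blast
  ultimately obtain w where w: "w \<in> cball z R" "\<And>u. u \<in> cball z R \<Longrightarrow> F w \<le> F u"
    using compact_attains_min_open_superlevel[of "cball z R" F, OF compact_cball] by blast
  have "F w \<le> F u" for u
    using w far[of u] \<open>xs \<in> cball z R\<close> by (metis le_less_trans less_imp_le)
  then show ?thesis
    unfolding F_def q_def is_arg_min_def by (auto simp: not_less)
qed

lemma prox_is_arg_min:
  assumes "0 < \<gamma>"
  shows "is_arg_min (\<lambda>u. ereal (a \<bullet> u + \<gamma> / 2 * (norm (u - z))\<^sup>2) + \<pi> u) (\<lambda>_. True) (prox a \<gamma> z)"
  using prox_exists[OF assms] unfolding prox_def prox_objective arg_min_def
  by (rule someI_ex)

lemma prox_dom: "0 < \<gamma> \<Longrightarrow> prox a \<gamma> z \<in> domain_of \<pi>"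
  by (rule minimizer_finite(1)[OF prox_is_arg_min])

lemma prox_subgradient:
  assumes "0 < \<gamma>" "u \<in> domain_of \<pi>"
  shows "P (prox a \<gamma> z) \<le> P u + (a + \<gamma> *\<^sub>R (prox a \<gamma> z - z)) \<bullet> (u - prox a \<gamma> z)"
proof (rule minimizer_subgradient[OF prox_is_arg_min[OF assms(1)] _ assms(2)])
  show "GDERIV (\<lambda>u. a \<bullet> u + \<gamma> / 2 * (norm (u - z))\<^sup>2) (prox a \<gamma> z) :> a + \<gamma> *\<^sub>R (prox a \<gamma> z - z)"
    unfolding gderiv_def power2_norm_eq_inner
    by (rule derivative_eq_intros refl)+
      (simp add: fun_eq_iff inner_add_right inner_commute)
qed

text \<open>Expanding \<open>norm (u - z)\<close> around the prox point turns the inner product in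
  \<open>prox_subgradient\<close> into squared distances. The term in
  \<open>u - prox a \<gamma> z\<close> later becomes the new distance in the potential.\<close>

lemma prox_three_point:
  assumes "0 < \<gamma>" "u \<in> domain_of \<pi>"
  shows "P (prox a \<gamma> z) + a \<bullet> prox a \<gamma> z + \<gamma> / 2 * (norm (prox a \<gamma> z - z))\<^sup>2
           + \<gamma> / 2 * (norm (u - prox a \<gamma> z))\<^sup>2
         \<le> P u + a \<bullet> u + \<gamma> / 2 * (norm (u - z))\<^sup>2"
proof -
  define w where "w = prox a \<gamma> z"
  have "(norm (u - z))\<^sup>2 = (norm (u - w))\<^sup>2 + (norm (w - z))\<^sup>2 + 2 * ((w - z) \<bullet> (u - w))"
    by (simp add: power2_norm_eq_inner inner_simps inner_commute)
  then have "\<gamma> / 2 * (norm (u - z))\<^sup>2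
      = \<gamma> / 2 * (norm (u - w))\<^sup>2 + \<gamma> / 2 * (norm (w - z))\<^sup>2 + \<gamma> * ((w - z) \<bullet> (u - w))"
    by (simp add: distrib_left)
  with prox_subgradient[OF assms, of a z] show ?thesis
    by (simp add: w_def[symmetric] inner_add_left inner_diff_right right_diff_distrib add_divide_distrib diff_divide_distrib)
qed

text \<open>Testing each subgradient inequality at the other prox point and adding cancels
  \<open>P\<close>. On the right only the first prox point occurs, so with it fixed the bound
  vanishes as the data converge.\<close>

lemma prox_stability:
  assumes "0 < \<gamma>" "0 < \<gamma>'"
  shows "\<gamma>' * norm (prox a' \<gamma>' z - prox a \<gamma> z)
           \<le> norm (a' - a) + \<bar>\<gamma>' - \<gamma>\<bar> * norm (prox a \<gamma> z - z)"
proof -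
  define w w' where "w = prox a \<gamma> z" and "w' = prox a' \<gamma>' z"
  define d where "d = w' - w"
  define v where "v = (a' - a) + (\<gamma>' - \<gamma>) *\<^sub>R (w - z)"
  have "P w \<le> P w' + (a + \<gamma> *\<^sub>R (w - z)) \<bullet> d"
    using prox_subgradient[OF assms(1) prox_dom[OF assms(2)]] by (simp add: w_def w'_def d_def)
  moreover have "P w' \<le> P w + (a' + \<gamma>' *\<^sub>R (d + (w - z))) \<bullet> (- d)"
    using prox_subgradient[OF assms(2) prox_dom[OF assms(1)]] by (simp add: w_def w'_def d_def)
  ultimately have "\<gamma>' * (d \<bullet> d) \<le> - (v \<bullet> d)"
    by (simp add: v_def inner_simps algebra_simps)
  also have "\<dots> \<le> norm v * norm d"
    using Cauchy_Schwarz_ineq2[of v d] by linarith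
  finally have "(\<gamma>' * norm d) * norm d \<le> norm v * norm d"
    by (simp add: power2_norm_eq_inner[symmetric] power2_eq_square mult.assoc)
  then have "\<gamma>' * norm d \<le> norm v"
    by (cases "d = 0") auto
  also have "norm v \<le> norm (a' - a) + \<bar>\<gamma>' - \<gamma>\<bar> * norm (w - z)"
    unfolding v_def by (metis norm_scaleR norm_triangle_ineq)
  finally show ?thesis
    by (simp add: d_def w_def w'_def)
qed

lemma continuous_on_prox:
  fixes a :: "'b::topological_space \<Rightarrow> 'a"
  assumes a: "continuous_on S a" and \<gamma>: "continuous_on S \<gamma>" "\<And>L. L \<in> S \<Longrightarrow> 0 < \<gamma> L"
  shows "continuous_on S (\<lambda>L. prox (a L) (\<gamma> L) z)"
  unfolding continuous_on_def
proof
  fix L assume L: "L \<in> S"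
  define B where "B L' = (norm (a L' - a L) + \<bar>\<gamma> L' - \<gamma> L\<bar> * norm (prox (a L) (\<gamma> L) z - z)) / \<gamma> L'" for L'
  show "((\<lambda>L. prox (a L) (\<gamma> L) z) \<longlongrightarrow> prox (a L) (\<gamma> L) z) (at L within S)"
  proof (rule LIM_zero_cancel, rule Lim_null_comparison)
    have "norm (prox (a L') (\<gamma> L') z - prox (a L) (\<gamma> L) z) \<le> B L'" if "L' \<in> S" for L'
      using prox_stability[of "\<gamma> L" "\<gamma> L'" "a L'" z "a L"] \<gamma>(2) L that
      by (simp add: B_def field_simps)
    then show "\<forall>\<^sub>F L' in at L within S. norm (prox (a L') (\<gamma> L') z - prox (a L) (\<gamma> L) z) \<le> B L'"
      by (auto simp: eventually_at_filter)
    have "(B \<longlongrightarrow> (norm (a L - a L) + \<bar>\<gamma> L - \<gamma> L\<bar> * norm (prox (a L) (\<gamma> L) z - z)) / \<gamma> L) (at L within S)"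
      unfolding B_def using a \<gamma>(1) \<gamma>(2)[OF L] L
      by (intro tendsto_intros) (auto simp: continuous_on_def)
    then show "(B \<longlongrightarrow> 0) (at L within S)"
      by simp
  qed
qed

section \<open>Trial points\<close>

text \<open>At \<mu> = 0 the parameter rule gives \<open>\<gamma> = L * \<alpha>\<close> and hence
  \<open>\<beta> = 1\<close>, so the inner combination of \<open>y\<close> and \<open>z\<close>
  collapses to \<open>z\<close>.\<close>

definition trial_x :: "'a \<Rightarrow> 'a \<Rightarrow> real \<Rightarrow> 'a" where
  "trial_x y z \<alpha> = (1 - \<alpha>) *\<^sub>R y + \<alpha> *\<^sub>R z"

definition trial_z :: "'a \<Rightarrow> 'a \<Rightarrow> real \<Rightarrow> real \<Rightarrow> 'a" where
  "trial_z y z \<alpha> L = prox (grad g (trial_x y z \<alpha>)) (L * \<alpha>) z"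

definition trial_y :: "'a \<Rightarrow> 'a \<Rightarrow> real \<Rightarrow> real \<Rightarrow> 'a" where
  "trial_y y z \<alpha> L = (1 - \<alpha>) *\<^sub>R y + \<alpha> *\<^sub>R trial_z y z \<alpha> L"

definition descent :: "real \<Rightarrow> 'a \<Rightarrow> 'a \<Rightarrow> bool" where
  "descent L x y \<longleftrightarrow> g y \<le> g x + grad g x \<bullet> (y - x) + L / 2 * (norm (y - x))\<^sup>2"

text \<open>The tangent at \<open>y\<close> bounds the linearization error by the gradient
  difference, so \<L> enters only at the pair \<open>(x, y)\<close> itself, not along the segment.
  The price is the factor 2 that reappears in the definition of \<open>L1\<close>.\<close>

lemma descent_if_smooth:
  assumes "2 * \<L> x y \<le> L"
  shows "descent L x y"
proof -
  have "g y - g x - grad g x \<bullet> (y - x) \<le> (grad g y - grad g x) \<bullet> (y - x)"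
    using g_above_tangent[of y x] by (simp add: inner_simps)
  also have "\<dots> \<le> norm (grad g y - grad g x) * norm (y - x)"
    by (rule norm_cauchy_schwarz)
  also have "\<dots> \<le> (\<L> x y * norm (y - x)) * norm (y - x)"
    using g_smooth by (intro mult_right_mono) (auto simp: generalized_smooth_def)
  also have "\<dots> = \<L> x y * (norm (y - x))\<^sup>2"
    by (simp add: power2_eq_square)
  also have "\<dots> \<le> L / 2 * (norm (y - x))\<^sup>2"
    using assms by (intro mult_right_mono) auto
  finally show ?thesis
    by (simp add: descent_def)
qed

section \<open>Accepted trials: decrease of the potential and confinement to the ball\<close>

lemma trial_dom:
  assumes "0 < L" "0 < \<alpha>" "\<alpha> \<le> 1" "y \<in> domain_of \<pi>"
  shows "trial_z y z \<alpha> L \<in> domain_of \<pi>" "trial_y y z \<alpha> L \<in> domain_of \<pi>"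
proof -
  show z: "trial_z y z \<alpha> L \<in> domain_of \<pi>"
    using assms by (simp add: trial_z_def prox_dom)
  show "trial_y y z \<alpha> L \<in> domain_of \<pi>"
    unfolding trial_y_def using assms z by (intro convex_P(1)) auto
qed

text \<open>Weight \<open>1 - \<alpha>\<close> goes to the tangent bound at \<open>y\<close>, weight
  \<alpha> to the one at \<open>xs\<close> combined with the prox inequality. Since
  \<open>y' - x = \<alpha> *\<^sub>R (w - z)\<close>, the quadratic term of the acceptance test
  cancels the one gained from the prox step.\<close>

lemma accepted_trial_gap:
  assumes L: "0 < L" and \<alpha>: "0 < \<alpha>" "\<alpha> \<le> 1" and y: "y \<in> domain_of \<pi>"
    and acc: "descent L (trial_x y z \<alpha>) (trial_y y z \<alpha> L)"
  shows "gap (trial_y y z \<alpha> L) + L * \<alpha>\<^sup>2 / 2 * (norm (xs - trial_z y z \<alpha> L))\<^sup>2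
           \<le> (1 - \<alpha>) * gap y + L * \<alpha>\<^sup>2 / 2 * (norm (xs - z))\<^sup>2"
proof -
  define x w y' where "x = trial_x y z \<alpha>" and "w = trial_z y z \<alpha> L" and "y' = trial_y y z \<alpha> L"
  define G where "G = grad g x"
  have y': "y' = (1 - \<alpha>) *\<^sub>R y + \<alpha> *\<^sub>R w"
    by (simp add: y'_def w_def trial_y_def)
  have "y' - x = \<alpha> *\<^sub>R (w - z)"
    by (simp add: y' x_def trial_x_def algebra_simps)
  then have sq: "(norm (y' - x))\<^sup>2 = \<alpha>\<^sup>2 * (norm (w - z))\<^sup>2"
    by (simp add: power_mult_distrib)
  have split: "y' - x = (1 - \<alpha>) *\<^sub>R (y - x) + \<alpha> *\<^sub>R (w - x)"
    by (simp add: y' algebra_simps)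
  have "g y' \<le> g x + G \<bullet> (y' - x) + L / 2 * (\<alpha>\<^sup>2 * (norm (w - z))\<^sup>2)"
    using acc by (simp add: descent_def x_def y'_def G_def sq[unfolded x_def y'_def])
  also have "G \<bullet> (y' - x) = (1 - \<alpha>) * (G \<bullet> (y - x)) + \<alpha> * (G \<bullet> (w - x))"
    by (simp add: split inner_add_right)
  finally have g1: "g y' \<le> (1 - \<alpha>) * (g x + G \<bullet> (y - x)) + \<alpha> * (g x + G \<bullet> (w - x))
      + L * \<alpha>\<^sup>2 / 2 * (norm (w - z))\<^sup>2"
    by (simp add: algebra_simps)
  have g2: "(1 - \<alpha>) * (g x + G \<bullet> (y - x)) \<le> (1 - \<alpha>) * g y"
    using g_above_tangent[of x y] \<alpha> by (intro mult_left_mono) (auto simp: G_def)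
  have P1: "P y' \<le> (1 - \<alpha>) * P y + \<alpha> * P w"
    unfolding y' w_def using L \<alpha> y trial_dom(1) by (intro convex_P(2)) auto
  have "P w + G \<bullet> w + (L * \<alpha>) / 2 * (norm (w - z))\<^sup>2 + (L * \<alpha>) / 2 * (norm (xs - w))\<^sup>2
      \<le> P xs + G \<bullet> xs + (L * \<alpha>) / 2 * (norm (xs - z))\<^sup>2"
    unfolding w_def G_def x_def trial_z_def using L \<alpha> xs_dom by (intro prox_three_point) auto
  moreover have "g x + G \<bullet> (xs - x) \<le> g xs"
    unfolding G_def by (rule g_above_tangent)
  ultimately have "P w + (g x + G \<bullet> (w - x)) + (L * \<alpha>) / 2 * (norm (w - z))\<^sup>2
      + (L * \<alpha>) / 2 * (norm (xs - w))\<^sup>2 \<le> g xs + P xs + (L * \<alpha>) / 2 * (norm (xs - z))\<^sup>2"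
    by (simp add: inner_diff_right)
  then have "\<alpha> * (P w + (g x + G \<bullet> (w - x)) + (L * \<alpha>) / 2 * (norm (w - z))\<^sup>2
      + (L * \<alpha>) / 2 * (norm (xs - w))\<^sup>2) \<le> \<alpha> * (g xs + P xs + (L * \<alpha>) / 2 * (norm (xs - z))\<^sup>2)"
    using \<alpha> by (intro mult_left_mono) auto
  then have "\<alpha> * P w + \<alpha> * (g x + G \<bullet> (w - x)) + L * \<alpha>\<^sup>2 / 2 * (norm (w - z))\<^sup>2
      + L * \<alpha>\<^sup>2 / 2 * (norm (xs - w))\<^sup>2 \<le> \<alpha> * (g xs + P xs) + L * \<alpha>\<^sup>2 / 2 * (norm (xs - z))\<^sup>2"
    by (simp add: distrib_left power2_eq_square mult.assoc mult.left_commute)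
  with g1 g2 P1 have "g y' + P y' + L * \<alpha>\<^sup>2 / 2 * (norm (xs - w))\<^sup>2
      \<le> (1 - \<alpha>) * g y + (1 - \<alpha>) * P y + \<alpha> * (g xs + P xs) + L * \<alpha>\<^sup>2 / 2 * (norm (xs - z))\<^sup>2"
    by linarith
  then show ?thesis
    unfolding gap_def y'_def[symmetric] w_def[symmetric] by (simp add: algebra_simps)
qed

text \<open>The scalar condition is what both kinds of iterations have in common: for the first one
  \<open>\<alpha> = 1\<close> and \<open>z\<close> is the starting point, later ones inherit it from the previous potential.\<close>

lemma accepted_trial_in_ball:
  assumes L: "0 < L" and \<alpha>: "0 < \<alpha>" "\<alpha> \<le> 1" and y: "y \<in> domain_of \<pi>" "y \<in> cball xs D"
    and ready: "(1 - \<alpha>) * gap y + L * \<alpha>\<^sup>2 / 2 * (norm (xs - z))\<^sup>2 \<le> L * \<alpha>\<^sup>2 / 2 * D\<^sup>2"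
    and acc: "descent L (trial_x y z \<alpha>) (trial_y y z \<alpha> L)"
  shows "trial_z y z \<alpha> L \<in> cball xs D" "trial_y y z \<alpha> L \<in> cball xs D"
proof -
  have "0 \<le> D"
    using y(2) by (auto intro: order_trans[OF zero_le_dist])
  have "0 \<le> gap (trial_y y z \<alpha> L)"
    using trial_dom(2)[OF L \<alpha> y(1)] by (rule gap_nonneg)
  with accepted_trial_gap[OF L \<alpha> y(1) acc] ready
  have "L * \<alpha>\<^sup>2 / 2 * (norm (xs - trial_z y z \<alpha> L))\<^sup>2 \<le> L * \<alpha>\<^sup>2 / 2 * D\<^sup>2"
    by linarith
  moreover have "0 < L * \<alpha>\<^sup>2 / 2"
    using L \<alpha> by simp
  ultimately have "(norm (xs - trial_z y z \<alpha> L))\<^sup>2 \<le> D\<^sup>2"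
    by (simp only: mult_le_cancel_left_pos)
  then show z: "trial_z y z \<alpha> L \<in> cball xs D"
    using \<open>0 \<le> D\<close> by (simp add: dist_norm power2_le_iff_abs_le)
  show "trial_y y z \<alpha> L \<in> cball xs D"
    unfolding trial_y_def using \<alpha> z y(2) by (intro convexD[OF convex_cball]) auto
qed

text \<open>Acceptance at one value says nothing directly about another, because the trial points
  move. Continuity carries confinement from \<open>L'\<close> to all values above \<open>L1\<close>,
  and confinement then yields acceptance.\<close>

lemma accepted_above_smoothness_bound:
  fixes \<alpha> :: "real \<Rightarrow> real"
  assumes \<alpha>: "continuous_on {0<..} \<alpha>" "\<And>L. 0 < L \<Longrightarrow> 0 < \<alpha> L" "\<And>L. 0 < L \<Longrightarrow> \<alpha> L \<le> 1"
    and y: "y \<in> domain_of \<pi>" "y \<in> cball xs D" and z: "z \<in> cball xs D"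
    and ready: "\<And>L. 0 < L \<Longrightarrow>
      (1 - \<alpha> L) * gap y + L * (\<alpha> L)\<^sup>2 / 2 * (norm (xs - z))\<^sup>2 \<le> L * (\<alpha> L)\<^sup>2 / 2 * D\<^sup>2"
    and L1: "0 < L1" "\<And>u v. u \<in> cball xs D \<Longrightarrow> v \<in> cball xs D \<Longrightarrow> 2 * \<L> u v \<le> L1"
    and L': "L1 < L'" "descent L' (trial_x y z (\<alpha> L')) (trial_y y z (\<alpha> L') L')"
    and L: "L1 < L"
  shows "descent L (trial_x y z (\<alpha> L)) (trial_y y z (\<alpha> L) L)"
proof -
  define I where "I = {L1<..}"
  define X Y where "X L = trial_x y z (\<alpha> L)" and "Y L = trial_y y z (\<alpha> L) L" for L
  have pos: "0 < L" if "L \<in> I" for L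
    using that L1(1) by (simp add: I_def)
  have c\<alpha>: "continuous_on I \<alpha>"
    using \<alpha>(1) by (rule continuous_on_subset) (use pos in auto)
  then have cX: "continuous_on I X"
    unfolding X_def trial_x_def by (intro continuous_intros)
  have "continuous_on I (\<lambda>L. grad g (X L))"
    using continuous_on_compose2[OF continuous_grad cX] by simp
  then have "continuous_on I (\<lambda>L. trial_z y z (\<alpha> L) L)"
    unfolding trial_z_def X_def[symmetric] using c\<alpha> pos \<alpha>(2)
    by (intro continuous_on_prox continuous_intros) auto
  then have cY: "continuous_on I Y"
    unfolding Y_def trial_y_def using c\<alpha> by (intro continuous_intros)
  have "continuous_on UNIV (\<lambda>p. \<L> (fst p) (snd p))"
    using g_smooth by (simp add: generalized_smooth_def)
  from continuous_on_compose2[OF this continuous_on_Pair[OF cX cY]]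
  have "continuous_on I (\<lambda>L. L - 2 * \<L> (X L) (Y L))"
    by (intro continuous_intros) auto
  \<comment> \<open>A strict inequality gives a relatively open set, membership in a closed ball a
    relatively closed one; the two sets turn out to be equal.\<close>
  then have "openin (top_of_set I) (I \<inter> (\<lambda>L. L - 2 * \<L> (X L) (Y L)) -` {0<..})"
    by (intro continuous_openin_preimage_gen) auto
  moreover have "closedin (top_of_set I) (I \<inter> Y -` cball xs D)"
    using cY by (intro continuous_closedin_preimage) auto
  moreover have XD: "X L \<in> cball xs D" if "L \<in> I" for L
    unfolding X_def trial_x_def using \<alpha>(2,3)[OF pos[OF that]] y(2) z
    by (intro convexD[OF convex_cball]) auto
  have YD: "Y L \<in> cball xs D" if "L \<in> I" "descent L (X L) (Y L)" for L
    using accepted_trial_in_ball(2)[OF pos \<alpha>(2,3) y ready] that pos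
    by (simp add: X_def Y_def)
  \<comment> \<open>Left to right, the smoothness bound forces acceptance and acceptance forces
    confinement; right to left, \<open>L1\<close> bounds \<open>2 * \<L>\<close> inside the ball and
    \<open>L\<close> exceeds \<open>L1\<close>.\<close>
  have "I \<inter> (\<lambda>L. L - 2 * \<L> (X L) (Y L)) -` {0<..} = I \<inter> Y -` cball xs D"
  proof (intro equalityI subsetI)
    fix L assume "L \<in> I \<inter> (\<lambda>L. L - 2 * \<L> (X L) (Y L)) -` {0<..}"
    then show "L \<in> I \<inter> Y -` cball xs D"
      using YD[of L] descent_if_smooth[of "X L" "Y L" L] by auto
  next
    fix L assume L: "L \<in> I \<inter> Y -` cball xs D"
    then have "2 * \<L> (X L) (Y L) \<le> L1"
      using XD by (intro L1(2)) auto
    with L show "L \<in> I \<inter> (\<lambda>L. L - 2 * \<L> (X L) (Y L)) -` {0<..}"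
      by (auto simp: I_def)
  qed
  moreover have "connected I"
    by (simp add: I_def)
  \<comment> \<open>The accepted value makes the clopen set nonempty.\<close>
  moreover have "L' \<in> I \<inter> Y -` cball xs D"
    using L' YD[of L'] by (auto simp: I_def X_def Y_def)
  ultimately have "I \<inter> Y -` cball xs D = I"
    unfolding connected_clopen by (metis empty_iff)
  moreover have "L \<in> I"
    using L by (simp add: I_def)
  ultimately have "Y L \<in> cball xs D"
    by blast
  then have "2 * \<L> (X L) (Y L) \<le> L1"
    using XD[OF \<open>L \<in> I\<close>] by (intro L1(2))
  then show ?thesis
    using descent_if_smooth[of "X L" "Y L" L] L by (simp add: X_def Y_def)
qed

section \<open>Runs of the method\<close>

definition trial_weight :: "nat \<Rightarrow> real \<Rightarrow> real \<Rightarrow> real" where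
  "trial_weight t b L = (if t = 1 then 1 else agls_alpha 0 b L)"

lemma agls_trial_0:
  assumes "0 < L" "\<alpha> = trial_weight t (agls_b 0 s) L" "0 < \<alpha>"
  shows "agls_trial g \<pi> 0 1 t s L =
    \<lparr>Lhat = L, weight = \<alpha>, xpt = trial_x (ypt s) (zpt s) \<alpha>,
     zpt = trial_z (ypt s) (zpt s) \<alpha> L, ypt = trial_y (ypt s) (zpt s) \<alpha> L\<rparr>"
proof -
  have "(if t = 1 then 1 else agls_alpha 0 (agls_b 0 s) L) = \<alpha>"
    by (simp add: assms(2) trial_weight_def)
  \<comment> \<open>Positivity of \<open>L\<close> and \<alpha> turns the quotient \<beta> into
    1.\<close>
  then show ?thesis
    using assms(1,3) unfolding agls_trial_def Let_def
    by (simp only:) (simp add: trial_x_def trial_z_def trial_y_def prox_def)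
qed

text \<open>What iteration \<open>t\<close> needs before its trial value is known. All
  \<open>L > 0\<close> are covered because every trial recomputes the weight and the connectedness
  argument passes through values that are never tried.\<close>

definition ready :: "real \<Rightarrow> nat \<Rightarrow> 'a agls_state \<Rightarrow> bool" where
  "ready D t s \<longleftrightarrow> 0 < Lhat s \<and> ypt s \<in> domain_of \<pi> \<and> ypt s \<in> cball xs D \<and> zpt s \<in> cball xs D \<and>
     continuous_on {0<..} (trial_weight t (agls_b 0 s)) \<and>
     (\<forall>L>0. let \<alpha> = trial_weight t (agls_b 0 s) L in 0 < \<alpha> \<and> \<alpha> \<le> 1 \<and>
        (1 - \<alpha>) * gap (ypt s) + L * \<alpha>\<^sup>2 / 2 * (norm (xs - zpt s))\<^sup>2 \<le> L * \<alpha>\<^sup>2 / 2 * D\<^sup>2)"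

text \<open>The last inequality is the bound \<open>D\<^sup>2 / 2\<close> on the potential
  \<open>gap / b + norm\<^sup>2 / 2\<close>, multiplied by \<open>b\<close>.\<close>

definition potential_bounded :: "real \<Rightarrow> 'a agls_state \<Rightarrow> bool" where
  "potential_bounded D s \<longleftrightarrow> 0 < Lhat s \<and> 0 < weight s \<and> ypt s \<in> domain_of \<pi> \<and>
     xpt s \<in> cball xs D \<and> ypt s \<in> cball xs D \<and> zpt s \<in> cball xs D \<and>
     gap (ypt s) + agls_b 0 s / 2 * (norm (xs - zpt s))\<^sup>2 \<le> agls_b 0 s / 2 * D\<^sup>2"

text \<open>The first weight 1 removes the gap term, so only the initial distance matters.\<close>

lemma ready_initial:
  assumes "0 < Lhat s" "x0 \<in> domain_of \<pi>" "ypt s = x0" "zpt s = x0" "D = norm (x0 - xs)"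
  shows "ready D 1 s"
  using assms
  by (simp add: ready_def trial_weight_def[abs_def] dist_norm norm_minus_commute)

text \<open>Multiplying the potential bound by \<open>1 - \<alpha>\<close> replaces \<open>b\<close>
  by \<open>L * \<alpha>\<^sup>2\<close>, thanks to the root equation.\<close>

lemma ready_if_potential_bounded:
  assumes "potential_bounded D s" "t \<noteq> 1"
  shows "ready D t s"
proof -
  define b where "b = agls_b 0 s"
  have b: "0 < b"
    using assms(1) by (simp add: b_def agls_b_def potential_bounded_def)
  have weight: "trial_weight t b = agls_alpha 0 b"
    using assms(2) by (simp add: trial_weight_def fun_eq_iff)
  have "(1 - \<alpha>) * gap (ypt s) + L * \<alpha>\<^sup>2 / 2 * (norm (xs - zpt s))\<^sup>2 \<le> L * \<alpha>\<^sup>2 / 2 * D\<^sup>2"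
    if L: "0 < L" and \<alpha>: "\<alpha> = agls_alpha 0 b L" for L \<alpha>
  proof -
    have "(1 - \<alpha>) * (gap (ypt s) + b / 2 * (norm (xs - zpt s))\<^sup>2) \<le> (1 - \<alpha>) * (b / 2 * D\<^sup>2)"
      using assms(1) agls_alpha_0_less_1[OF b L]
      by (intro mult_left_mono) (auto simp: potential_bounded_def b_def \<alpha>)
    then show ?thesis
      by (simp add: agls_alpha_0_root[OF b L] \<alpha> distrib_left mult.assoc)
  qed
  with assms(1) show ?thesis
    using agls_alpha_0_pos[OF b] agls_alpha_0_less_1[OF b] continuous_on_agls_alpha_0[OF b]
    by (simp add: ready_def Let_def weight b_def[symmetric] potential_bounded_def less_imp_le)
qed

lemma readyD:
  assumes "ready D t s" "0 < L" "\<alpha> = trial_weight t (agls_b 0 s) L"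
  shows "0 < \<alpha>" "\<alpha> \<le> 1"
    and "(1 - \<alpha>) * gap (ypt s) + L * \<alpha>\<^sup>2 / 2 * (norm (xs - zpt s))\<^sup>2 \<le> L * \<alpha>\<^sup>2 / 2 * D\<^sup>2"
  using assms by (auto simp: ready_def Let_def)

section \<open>One iteration of the line search\<close>

lemma agls_accepts_iff_descent:
  assumes "ready D t s" "0 < L" "\<alpha> = trial_weight t (agls_b 0 s) L"
  shows "agls_accepts g (agls_trial g \<pi> 0 1 t s L)
    \<longleftrightarrow> descent L (trial_x (ypt s) (zpt s) \<alpha>) (trial_y (ypt s) (zpt s) \<alpha> L)"
  using agls_trial_0[OF assms(2,3) readyD(1)[OF assms]]
  by (simp add: agls_accepts_def descent_def)

lemma potential_bounded_accepted:
  assumes s: "ready D t s" and L: "0 < L" and acc: "agls_accepts g (agls_trial g \<pi> 0 1 t s L)"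
  shows "potential_bounded D (agls_trial g \<pi> 0 1 t s L)"
proof -
  define \<alpha> where "\<alpha> = trial_weight t (agls_b 0 s) L"
  note \<alpha> = readyD[OF s L \<alpha>_def]
  have y: "ypt s \<in> domain_of \<pi>" "ypt s \<in> cball xs D" and z: "zpt s \<in> cball xs D"
    using s by (auto simp: ready_def)
  have d: "descent L (trial_x (ypt s) (zpt s) \<alpha>) (trial_y (ypt s) (zpt s) \<alpha> L)"
    using acc agls_accepts_iff_descent[OF s L \<alpha>_def] by blast
  have "trial_x (ypt s) (zpt s) \<alpha> \<in> cball xs D"
    unfolding trial_x_def using \<alpha> y(2) z by (intro convexD[OF convex_cball]) auto
  moreover have "gap (trial_y (ypt s) (zpt s) \<alpha> L)
      + L * \<alpha>\<^sup>2 / 2 * (norm (xs - trial_z (ypt s) (zpt s) \<alpha> L))\<^sup>2 \<le> L * \<alpha>\<^sup>2 / 2 * D\<^sup>2"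
    using accepted_trial_gap[OF L \<alpha>(1,2) y(1) d] \<alpha>(3) by (rule order_trans)
  ultimately show ?thesis
    unfolding agls_trial_0[OF L \<alpha>_def \<alpha>(1)] potential_bounded_def agls_b_def
      agls_state.simps add_0_right mult.commute[of "\<alpha>\<^sup>2"]
    using L \<alpha>(1) trial_dom(2)[OF L \<alpha>(1,2) y(1)] accepted_trial_in_ball[OF L \<alpha>(1,2) y \<alpha>(3) d]
    by blast
qed

text \<open>If the first trial passes, its estimate is known only as the shrunken old one. Otherwise
  the preceding trial was rejected, which caps its estimate by \<open>L1\<close>, and one factor
  \<tau>u follows.\<close>

lemma backtracking_step:
  assumes s: "ready D t s" and \<tau>: "0 < \<tau>d" "1 < \<tau>u"
    and L1: "0 < L1" "\<And>u v. u \<in> cball xs D \<Longrightarrow> v \<in> cball xs D \<Longrightarrow> 2 * \<L> u v \<le> L1"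
    and success: "\<exists>k. agls_accepts g (agls_backtrack g \<pi> 0 \<tau>d \<tau>u 1 t s k)"
    and s': "s' = agls_backtrack g \<pi> 0 \<tau>d \<tau>u 1 t s
               (LEAST k. agls_accepts g (agls_backtrack g \<pi> 0 \<tau>d \<tau>u 1 t s k))"
  shows "potential_bounded D s'"
    and "weight s' = trial_weight t (agls_b 0 s) (Lhat s')"
    and "Lhat s' = \<tau>d * Lhat s \<or> Lhat s' \<le> \<tau>u * L1"
proof -
  define L where "L k = \<tau>d * Lhat s * \<tau>u ^ k" for k
  have trial: "agls_backtrack g \<pi> 0 \<tau>d \<tau>u 1 t s k = agls_trial g \<pi> 0 1 t s (L k)" for k
    by (simp add: agls_backtrack_def L_def)
  have L: "0 < L k" for k
    using s \<tau> by (simp add: L_def ready_def)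
  define k where "k = (LEAST k. agls_accepts g (agls_trial g \<pi> 0 1 t s (L k)))"
  have s'_eq: "s' = agls_trial g \<pi> 0 1 t s (L k)"
    by (simp add: s' trial k_def)
  have acc: "agls_accepts g (agls_trial g \<pi> 0 1 t s (L k))"
    unfolding k_def using success unfolding trial by (rule LeastI_ex)
  show "potential_bounded D s'"
    unfolding s'_eq using s L acc by (rule potential_bounded_accepted)
  have Lhat: "Lhat s' = L k"
    by (simp add: s'_eq agls_trial_0[OF L refl readyD(1)[OF s L refl]])
  show "weight s' = trial_weight t (agls_b 0 s) (Lhat s')"
    unfolding Lhat by (simp add: s'_eq agls_trial_0[OF L refl readyD(1)[OF s L refl]])
  show "Lhat s' = \<tau>d * Lhat s \<or> Lhat s' \<le> \<tau>u * L1"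
  proof (cases k)
    case 0
    then show ?thesis by (simp add: Lhat L_def)
  next
    case (Suc j)
    have rejected: "\<not> agls_accepts g (agls_trial g \<pi> 0 1 t s (L j))"
      using not_less_Least[of j "\<lambda>k. agls_accepts g (agls_trial g \<pi> 0 1 t s (L k))"] Suc
      by (simp add: k_def)
    have Lk: "L k = \<tau>u * L j"
      by (simp add: Suc L_def)
    \<comment> \<open>Above \<open>L1\<close>, acceptance at the larger value \<open>L k\<close>
      would spread to \<open>L j\<close>, which was rejected.\<close>
    have "L j \<le> L1"
    proof (rule ccontr)
      assume "\<not> L j \<le> L1"
      then have "L1 < L j"
        by simp
      moreover have "L j < L k"
        using \<tau>(2) L[of j] by (simp add: Lk)
      ultimately have "L1 < L k"
        by linarith
      have "descent (L j)
          (trial_x (ypt s) (zpt s) (trial_weight t (agls_b 0 s) (L j)))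
          (trial_y (ypt s) (zpt s) (trial_weight t (agls_b 0 s) (L j)) (L j))"
      proof (rule accepted_above_smoothness_bound[OF _ _ _ _ _ _ _ L1 \<open>L1 < L k\<close> _ \<open>L1 < L j\<close>])
        show "continuous_on {0<..} (trial_weight t (agls_b 0 s))" "ypt s \<in> domain_of \<pi>"
          "ypt s \<in> cball xs D" "zpt s \<in> cball xs D"
          using s by (simp_all only: ready_def)
        show "descent (L k) (trial_x (ypt s) (zpt s) (trial_weight t (agls_b 0 s) (L k)))
            (trial_y (ypt s) (zpt s) (trial_weight t (agls_b 0 s) (L k)) (L k))"
          using acc unfolding agls_accepts_iff_descent[OF s L refl] .
      qed (fact readyD[OF s _ refl])+
      with rejected show False
        unfolding agls_accepts_iff_descent[OF s L refl] by (rule notE)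
    qed
    then show ?thesis
      using \<tau>(2) by (simp add: Lhat Lk)
  qed
qed

section \<open>The whole run: confinement and decay of the weights\<close>

context
  fixes \<tau>d \<tau>u L0 D L1 :: real and x0 :: 'a and T :: nat and run :: "nat \<Rightarrow> 'a agls_state"
  assumes \<tau>: "0 < \<tau>d" "\<tau>d < 1" "1 < \<tau>u" and L0: "0 < L0" and x0: "x0 \<in> domain_of \<pi>"
    and run: "run = agls g \<pi> 0 \<tau>d \<tau>u 1 L0 x0"
    and success: "\<forall>t\<in>{1..T}. agls_succeeds g \<pi> 0 \<tau>d \<tau>u 1 L0 x0 t"
    and D: "D = norm (x0 - xs)"
    and L1: "0 < L1" "\<forall>u\<in>cball xs D. \<forall>v\<in>cball xs D. 2 * \<L> u v \<le> L1"
begin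

lemma run_step:
  assumes "ready D (Suc n) (run n)" "Suc n \<le> T"
  shows "potential_bounded D (run (Suc n))"
    and "weight (run (Suc n)) = trial_weight (Suc n) (agls_b 0 (run n)) (Lhat (run (Suc n)))"
    and "Lhat (run (Suc n)) = \<tau>d * Lhat (run n) \<or> Lhat (run (Suc n)) \<le> \<tau>u * L1"
proof -
  have ex: "\<exists>k. agls_accepts g (agls_backtrack g \<pi> 0 \<tau>d \<tau>u 1 (Suc n) (run n) k)"
    using bspec[OF success, of "Suc n"] assms(2) by (simp add: agls_succeeds_def run)
  have eq: "run (Suc n) = agls_backtrack g \<pi> 0 \<tau>d \<tau>u 1 (Suc n) (run n)
      (LEAST k. agls_accepts g (agls_backtrack g \<pi> 0 \<tau>d \<tau>u 1 (Suc n) (run n) k))"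
    by (simp add: run Let_def)
  show "potential_bounded D (run (Suc n))"
    and "weight (run (Suc n)) = trial_weight (Suc n) (agls_b 0 (run n)) (Lhat (run (Suc n)))"
    and "Lhat (run (Suc n)) = \<tau>d * Lhat (run n) \<or> Lhat (run (Suc n)) \<le> \<tau>u * L1"
    by (rule backtracking_step[OF assms(1) \<tau>(1,3) L1(1) L1(2)[rule_format] ex eq]; assumption)+
qed

lemma run_ready: "n \<le> T \<Longrightarrow> ready D (Suc n) (run n)"
proof (induction n)
  case 0
  have "ready D 1 (run 0)"
    by (rule ready_initial[OF _ x0 _ _ D]) (simp_all add: run L0)
  then show ?case
    by simp
next
  case (Suc n)
  then have "potential_bounded D (run (Suc n))"
    by (intro run_step(1)) simp_all
  then show ?case
    by (rule ready_if_potential_bounded) simp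
qed

lemma run_potential_bounded:
  assumes "1 \<le> n" "n \<le> T"
  shows "potential_bounded D (run n)"
proof -
  obtain m where m: "n = Suc m"
    using assms(1) by (cases n) auto
  then have "ready D (Suc m) (run m)"
    using assms(2) by (intro run_ready) simp
  then show ?thesis
    using assms(2) unfolding m by (rule run_step(1))
qed

lemma run_in_ball:
  assumes "n \<le> T"
  shows "xpt (run n) \<in> cball xs D" "ypt (run n) \<in> cball xs D" "zpt (run n) \<in> cball xs D"
proof -
  have "xpt (run n) \<in> cball xs D \<and> ypt (run n) \<in> cball xs D \<and> zpt (run n) \<in> cball xs D"
  proof (cases "n = 0")
    case True
    \<comment> \<open>In state 0 all three points are \<open>x0\<close>, at distance exactly
      \<open>D\<close>.\<close>
    have "x0 \<in> cball xs D"
      by (simp add: D dist_norm norm_minus_commute)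
    with True show ?thesis
      by (simp add: run)
  next
    case False
    then have "potential_bounded D (run n)"
      using assms by (intro run_potential_bounded) simp_all
    then show ?thesis
      unfolding potential_bounded_def by blast
  qed
  then show "xpt (run n) \<in> cball xs D" "ypt (run n) \<in> cball xs D" "zpt (run n) \<in> cball xs D"
    by blast+
qed

text \<open>Each estimate is either a shrunken predecessor, bounded by induction, or at most
  \<open>\<tau>u * L1\<close> outright; \<open>M\<close> starts this at \<open>L0\<close>. The
  estimate bound in turn drives \<open>weight_recursion_decay\<close>, with
  \<open>c = n + 1\<close>.\<close>

lemma run_decay:
  assumes M: "\<tau>d * L0 \<le> \<tau>u * L1" and "1 \<le> n" "n \<le> T"
  shows "Lhat (run n) \<le> \<tau>u * L1 \<and> agls_b 0 (run n) * (real n + 1)\<^sup>2 \<le> 4 * (\<tau>u * L1)"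
  using assms(2,3)
proof (induction n rule: nat_induct_at_least)
  case base
  have "Lhat (run 0) = L0"
    by (simp add: run)
  note step = run_step[OF run_ready, of 0]
  have "Lhat (run 1) \<le> \<tau>u * L1"
    using step(3) base M \<open>Lhat (run 0) = L0\<close> by auto
  moreover have "weight (run 1) = 1"
    using step(2) base by (simp add: trial_weight_def)
  \<comment> \<open>With weight 1, \<open>b\<close> equals the first estimate, and
    \<open>(1 + 1)\<^sup>2 = 4\<close> matches the constant on the right.\<close>
  ultimately show ?case
    by (simp add: agls_b_def power2_eq_square)
next
  case (Suc n)
  then have n: "n \<le> T"
    by simp
  note step = run_step[OF run_ready[OF n] Suc.prems]
  define b where "b = agls_b 0 (run n)"
  define L where "L = Lhat (run (Suc n))"
  define \<alpha> where "\<alpha> = agls_alpha 0 b L"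
  have pos: "0 < Lhat (run n)" "0 < L"
    using run_potential_bounded[OF Suc.hyps n] step(1) by (simp_all add: potential_bounded_def L_def)
  have b: "0 < b"
    using run_potential_bounded[OF Suc.hyps n] by (simp add: potential_bounded_def agls_b_def b_def)
  have "\<tau>d * Lhat (run n) \<le> Lhat (run n)"
    using pos \<tau>(2) by simp
  with step(3) Suc.IH[OF n] have LM: "L \<le> \<tau>u * L1"
    by (auto simp: L_def)
  have "weight (run (Suc n)) = \<alpha>"
    using step(2) Suc.hyps by (simp add: trial_weight_def \<alpha>_def b_def L_def)
  then have b': "agls_b 0 (run (Suc n)) = L * \<alpha>\<^sup>2"
    by (simp add: agls_b_def L_def)
  have "agls_b 0 (run (Suc n)) * ((real n + 1) + 1)\<^sup>2 \<le> 4 * (\<tau>u * L1)"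
  proof (rule weight_recursion_decay[OF b' _ _ _ pos(2) LM])
    show "agls_b 0 (run (Suc n)) = (1 - \<alpha>) * b" "0 < \<alpha>" "\<alpha> < 1"
      using agls_alpha_0_root[OF b pos(2)] agls_alpha_0_pos[OF b pos(2)]
        agls_alpha_0_less_1[OF b pos(2)] by (simp_all add: b' \<alpha>_def)
    show "b * (real n + 1)\<^sup>2 \<le> 4 * (\<tau>u * L1)"
      using Suc.IH[OF n] by (simp add: b_def)
  qed simp
  then show ?case
    using LM by (simp add: L_def add.commute)
qed

text \<open>Dropping the distance term leaves \<open>gap \<le> b / 2 * D\<^sup>2\<close>; the factor
  2 is the 4 of \<open>run_decay\<close> halved.\<close>

lemma run_gap:
  assumes "\<tau>d * L0 \<le> \<tau>u * L1" "1 \<le> T"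
  shows "gap (ypt (run T)) \<le> 2 * \<tau>u * L1 / (real T + 1)\<^sup>2 * D\<^sup>2"
proof -
  have pb: "potential_bounded D (run T)"
    using run_potential_bounded[OF assms(2)] by simp
  then have "0 \<le> agls_b 0 (run T)"
    by (simp add: potential_bounded_def agls_b_def)
  then have "0 \<le> agls_b 0 (run T) / 2 * (norm (xs - zpt (run T)))\<^sup>2"
    by simp
  with pb have "gap (ypt (run T)) \<le> agls_b 0 (run T) / 2 * D\<^sup>2"
    by (simp add: potential_bounded_def)
  also have "\<dots> \<le> 2 * \<tau>u * L1 / (real T + 1)\<^sup>2 * D\<^sup>2"
    using run_decay[OF assms order_refl] by (intro mult_right_mono) (auto simp: field_simps)
  finally show ?thesis .
qed

end

end

text \<open>The rate carries a premise because the first trial value is \<open>\<tau>d * L0\<close>: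
  if it exceeds \<open>\<tau>u * L1\<close> and is accepted at once, the estimates are not all
  bounded by \<open>\<tau>u * L1\<close>. Confinement holds whatever the size of the
  estimates.\<close>

theorem theorem6p1:
  fixes g :: "real ^ 'n \<Rightarrow> real" and \<pi> :: "real ^ 'n \<Rightarrow> ereal"
    and \<L> :: "real ^ 'n \<Rightarrow> real ^ 'n \<Rightarrow> real"
    and \<psi> :: "real ^ 'n \<Rightarrow> ereal"
    and x0 xstar :: "real ^ 'n" and L0 \<tau>d \<tau>u D1 L1 :: real and T :: nat
    and run :: "nat \<Rightarrow> (real ^ 'n) agls_state"
  assumes g_convex: "convex_on UNIV g"
    and g_smooth: "generalized_smooth g \<L>"
    and pi_proper: "proper \<pi>"
    and pi_lsc: "lower_semicontinuous \<pi>"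
    and pi_convex: "strongly_convex 0 \<pi>"
    and psi: "\<psi> = (\<lambda>x. ereal (g x) + \<pi> x)"
    and xstar: "is_arg_min \<psi> (\<lambda>_. True) xstar"
    and x0: "x0 \<in> domain_of \<pi>"
    and L0: "0 < L0"
    and tau_d: "0 < \<tau>d" "\<tau>d < 1"
    and tau_u: "1 < \<tau>u"
    and T: "1 \<le> T"
    and run: "run = agls g \<pi> 0 \<tau>d \<tau>u 1 L0 x0"
    and success: "\<And>t. t \<in> {1..T} \<Longrightarrow> agls_succeeds g \<pi> 0 \<tau>d \<tau>u 1 L0 x0 t"
    and D1: "D1 = norm (x0 - xstar)"
    and L1: "L1 = (SUP p \<in> cball xstar D1 \<times> cball xstar D1. 2 * \<L> (fst p) (snd p))"
  shows "(\<forall>t \<le> T. xpt (run t) \<in> cball xstar D1 \<and> ypt (run t) \<in> cball xstar D1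
                  \<and> zpt (run t) \<in> cball xstar D1)
       \<and> (\<tau>d * L0 \<le> \<tau>u * L1 \<longrightarrow>
            \<psi> (ypt (run T)) - \<psi> xstar
              \<le> ereal (2 * \<tau>u * L1 / (real T + 1)\<^sup>2 * (norm (xstar - x0))\<^sup>2))"
proof -
  interpret composite_problem g \<pi> \<L> xstar
    using g_convex g_smooth pi_proper pi_lsc pi_convex xstar[unfolded psi]
    by (rule composite_problem.intro)
  \<comment> \<open>A real \<open>SUP\<close> is an upper bound only for a set bounded above;
    continuity of \<L> on the compact product of balls ensures this.\<close>
  define h where "h p = 2 * \<L> (fst p) (snd p)" for p
  have "continuous_on UNIV h"
    using g_smooth unfolding h_def generalized_smooth_def by (intro continuous_intros) auto
  then have "compact (h ` (cball xstar D1 \<times> cball xstar D1))"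
    by (intro compact_continuous_image compact_Times compact_cball) (auto intro: continuous_on_subset)
  then have bdd: "bdd_above (h ` (cball xstar D1 \<times> cball xstar D1))"
    by (intro bounded_imp_bdd_above compact_imp_bounded)
  have L1_ge: "\<forall>u\<in>cball xstar D1. \<forall>v\<in>cball xstar D1. 2 * \<L> u v \<le> L1"
  proof (intro ballI)
    fix u v assume "u \<in> cball xstar D1" "v \<in> cball xstar D1"
    then have "h (u, v) \<le> (SUP p\<in>cball xstar D1 \<times> cball xstar D1. h p)"
      by (intro cSUP_upper[OF _ bdd]) simp
    then show "2 * \<L> u v \<le> L1"
      by (simp add: L1 h_def)
  qed
  \<comment> \<open>The centre lies in the ball even if \<open>D1 = 0\<close>, so \<open>L1\<close>
    is positive.\<close>
  have "0 < 2 * \<L> xstar xstar"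
    using g_smooth by (simp add: generalized_smooth_def)
  also have "\<dots> \<le> L1"
    using L1_ge[rule_format, of xstar xstar] by (simp add: D1)
  finally have L1_pos: "0 < L1" .
  have "\<forall>t\<in>{1..T}. agls_succeeds g \<pi> 0 \<tau>d \<tau>u 1 L0 x0 t"
    using success by blast
  note facts = tau_d tau_u L0 x0 run this D1 L1_pos L1_ge
  \<comment> \<open>Both points lie in \<open>domain_of \<pi>\<close>, so the extended difference is
    the real one.\<close>
  have "\<psi> (ypt (run T)) - \<psi> xstar = ereal (gap (ypt (run T)))"
    using run_potential_bounded[OF facts T order_refl] xs_dom
    by (simp add: psi gap_def pi_eq potential_bounded_def)
  moreover have "gap (ypt (run T)) \<le> 2 * \<tau>u * L1 / (real T + 1)\<^sup>2 * (norm (xstar - x0))\<^sup>2"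
    if "\<tau>d * L0 \<le> \<tau>u * L1"
    using run_gap[OF facts that T] by (simp add: D1 norm_minus_commute)
  ultimately show ?thesis
    using run_in_ball[OF facts] by auto
qed

end
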